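(* Let $f(t)\in\mathbf{R}[t]$ be a polynomial of degree $n\ge 1$ with (not necessarily distinct) complex roots $\lambda_1,\ldots,\lambda_n$, listed with multiplicity. For every positive integer $m$ define the $n$-ary form of degree $m$ \[ \Phi_{m}(x_1,\ldots, x_n) = \sum_{j_1=1}^n \sum_{j_2=1}^n \cdots \sum_{j_{m}=1}^n \sum_{\ell=1}^n \lambda_{\ell}^{\sum_{t=1}^{m}(j_t-1)}\, x_{j_1}x_{j_2}\cdots x_{j_m}. \] Then the following are equivalent: (a) every root of $f(t)$ is real; (b) $\Phi_m$ is positive semidefinite for all positive even integers $m$; (c) $\Phi_m$ is positive semidefinite for some positive even integer $m$.
   Context: A real-valued function $\Phi(x_1,\ldots,x_n)$ is positive semidefinite if $\Phi(x_1,\ldots,x_n)\ge 0$ for all $(x_1,\ldots,x_n)\in\mathbf{R}^n$. (Since the non-real roots of $f$ occur in conjugate pairs with equal multiplicities, $\Phi_m$ has real coefficients.) *)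

theory Defs
  imports
    "HOL-Computational_Algebra.Computational_Algebra"
    "HOL-Library.FuncSet"
begin

text \<open>
  \<open>\<lambda>\<^sub>1, \<dots>, \<lambda>\<^sub>n\<close> is a list, in some order, of the complex roots of a real polynomial,
  repeated according to multiplicity; positions outside \<open>{1..n}\<close> are irrelevant.
\<close>

definition lists_roots :: "real poly \<Rightarrow> nat \<Rightarrow> (nat \<Rightarrow> complex) \<Rightarrow> bool" where
  "lists_roots f n lam \<longleftrightarrow>
     image_mset lam (mset_set {1..n}) = proots (map_poly complex_of_real f)"

text \<open>
  The \<open>m\<close>-fold sum over \<open>j\<^sub>1, \<dots>, j\<^sub>m\<close> is a single sum over the index functions
  \<open>j : {1..m} \<rightarrow> {1..n}\<close>. The convention \<open>0\<^sup>0 = 1\<close> applies to zero roots, and all \<open>j\<^sub>t\<close> are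
  at least 1, so the subtraction on naturals does not truncate.
\<close>

definition complex_root_form ::
    "nat \<Rightarrow> (nat \<Rightarrow> complex) \<Rightarrow> nat \<Rightarrow> (nat \<Rightarrow> real) \<Rightarrow> complex" where
  "complex_root_form n lam m x =
     (\<Sum>j \<in> {1..m} \<rightarrow>\<^sub>E {1..n}. \<Sum>l = 1..n.
        lam l ^ (\<Sum>t = 1..m. (j t - 1)) * complex_of_real (\<Prod>t = 1..m. x (j t)))"

text \<open>
  The same form as a real-valued function; taking the real part loses nothing for the roots
  of a real polynomial, see \<open>of_real_root_form\<close> below.
\<close>

definition root_form :: "nat \<Rightarrow> (nat \<Rightarrow> complex) \<Rightarrow> nat \<Rightarrow> (nat \<Rightarrow> real) \<Rightarrow> real" where
  "root_form n lam m x = Re (complex_root_form n lam m x)"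

text \<open>Points of \<open>\<real>\<^sup>n\<close> are the extensional functions on \<open>{1..n}\<close>.\<close>

definition pos_semidef :: "nat \<Rightarrow> ((nat \<Rightarrow> real) \<Rightarrow> real) \<Rightarrow> bool" where
  "pos_semidef n F \<longleftrightarrow> (\<forall>x \<in> {1..n} \<rightarrow>\<^sub>E UNIV. F x \<ge> 0)"

lemma map_poly_cnj_mult:
  "map_poly cnj (p * q) = map_poly cnj p * map_poly cnj q"
  by (subst poly_eq_poly_eq_iff [symmetric]) (simp add: fun_eq_iff)

lemma map_poly_cnj_of_real:
  "map_poly cnj (map_poly complex_of_real f) = map_poly complex_of_real f"
  by (rule poly_eqI) (simp add: coeff_map_poly)

lemma order_le_order_cnj:
  assumes "f \<noteq> 0"
  shows "order a (map_poly complex_of_real f) \<le> order (cnj a) (map_poly complex_of_real f)"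
proof -
  let ?p = "map_poly complex_of_real f"
  have nz: "?p \<noteq> 0"
    using assms by (simp add: map_poly_eq_0_iff)
  obtain q where q: "?p = [:- a, 1:] ^ order a ?p * q"
    using order_1 by (metis dvdE)
  have lin: "map_poly cnj [:- a, 1:] = [:- cnj a, 1:]"
    by (simp add: map_poly_pCons)
  have pow: "map_poly cnj ([:- a, 1:] ^ k) = [:- cnj a, 1:] ^ k" for k
    by (induction k) (simp_all only: power_0 power_Suc map_poly_cnj_mult lin map_poly_1' complex_cnj_one)
  have "?p = [:- cnj a, 1:] ^ order a ?p * map_poly cnj q"
    using arg_cong [OF q, of "map_poly cnj"]
    by (simp only: map_poly_cnj_of_real map_poly_cnj_mult pow)
  then have "[:- cnj a, 1:] ^ order a ?p dvd ?p"
    by (metis dvd_triv_left)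
  then show ?thesis
    using nz by (simp add: order_divides)
qed

lemma image_mset_cnj_proots:
  assumes "f \<noteq> 0"
  shows "image_mset cnj (proots (map_poly complex_of_real f)) = proots (map_poly complex_of_real f)"
proof (rule multiset_eqI)
  fix z
  let ?p = "map_poly complex_of_real f"
  have nz: "?p \<noteq> 0"
    using assms by (simp add: map_poly_eq_0_iff)
  have "cnj -` {z} \<inter> set_mset (proots ?p) = (if cnj z \<in># proots ?p then {cnj z} else {})"
    by auto
  then have "count (image_mset cnj (proots ?p)) z = count (proots ?p) (cnj z)"
    by (simp add: count_image_mset not_in_iff del: count_proots set_count_proots)
  moreover have "order (cnj z) ?p = order z ?p"
    using order_le_order_cnj [OF assms, of z] order_le_order_cnj [OF assms, of "cnj z"] by simp
  ultimately show "count (image_mset cnj (proots ?p)) z = count (proots ?p) z"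
    using nz by simp
qed

lemma of_real_root_form:
  assumes "f \<noteq> 0" and "lists_roots f n lam"
  shows "complex_of_real (root_form n lam m x) = complex_root_form n lam m x"
proof -
  let ?P = "proots (map_poly complex_of_real f)"
  have sum_eq: "(\<Sum>l = 1..n. g (lam l)) = sum_mset (image_mset g ?P)" for g :: "complex \<Rightarrow> complex"
    using assms(2) unfolding lists_roots_def sum_unfold_sum_mset
    by (simp add: multiset.map_comp o_def flip: assms(2)[unfolded lists_roots_def])
  have "cnj (\<Sum>l = 1..n. lam l ^ k) = (\<Sum>l = 1..n. lam l ^ k)" for k
  proof -
    have "cnj (\<Sum>l = 1..n. lam l ^ k) = (\<Sum>l = 1..n. cnj (lam l) ^ k)"
      by simp
    also have "\<dots> = sum_mset (image_mset (\<lambda>z. z ^ k) (image_mset cnj ?P))"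
      by (subst sum_eq) (simp add: multiset.map_comp o_def)
    also have "\<dots> = (\<Sum>l = 1..n. lam l ^ k)"
      by (simp only: image_mset_cnj_proots [OF assms(1)] sum_eq [of "\<lambda>z. z ^ k"])
    finally show ?thesis .
  qed
  then have "cnj (complex_root_form n lam m x) = complex_root_form n lam m x"
    by (simp add: complex_root_form_def flip: sum_distrib_right)
  then show ?thesis
    by (simp add: root_form_def complex_eq_iff)
qed

end

theory Submission
  imports Defs
begin

text \<open>
  Grouping the sum by roots, \<open>\<Phi>\<^sub>m(x) = \<Sum>\<^sub>l p(\<lambda>\<^sub>l)\<^sup>m\<close> with \<open>p(t) = \<Sum>\<^sub>j x\<^sub>j t\<^bsup>j-1\<^esup>\<close> an arbitrary real
  polynomial of degree below \<open>n\<close>. If all roots are real, this is a sum of even powers of reals.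
  If \<open>\<lambda>\<close> is a non-real root, interpolation yields a real \<open>p\<close> that vanishes at all roots other
  than \<open>\<lambda>\<close> and its conjugate and takes at \<open>\<lambda>\<close> an \<open>m\<close>-th root of \<open>-1\<close>, so that
  \<open>\<Phi>\<^sub>m(x) < 0\<close>.
\<close>

lemma complex_root_form_eq_sum_powers:
  "complex_root_form n lam m x
     = (\<Sum>l = 1..n. (\<Sum>j = 1..n. complex_of_real (x j) * lam l ^ (j - 1)) ^ m)"
proof -
  have "(\<Sum>j = 1..n. complex_of_real (x j) * lam l ^ (j - 1)) ^ m
      = (\<Sum>j \<in> {1..m} \<rightarrow>\<^sub>E {1..n}.
           lam l ^ (\<Sum>t = 1..m. (j t - 1)) * complex_of_real (\<Prod>t = 1..m. x (j t)))" for l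
  proof -
    have "(\<Sum>j = 1..n. complex_of_real (x j) * lam l ^ (j - 1)) ^ m
        = (\<Prod>t\<in>{1..m}. \<Sum>j\<in>{1..n}. complex_of_real (x j) * lam l ^ (j - 1))"
      by simp
    \<comment> \<open>Expanding the product picks one index \<open>j t\<close> from each of the m
      factors, which produces the index functions of the form.\<close>
    also have "\<dots> = (\<Sum>j \<in> {1..m} \<rightarrow>\<^sub>E {1..n}.
        \<Prod>t\<in>{1..m}. complex_of_real (x (j t)) * lam l ^ (j t - 1))"
      by (rule prod_sum_PiE) auto
    finally show ?thesis
      by (simp only: prod.distrib power_sum of_real_prod mult.commute)
  qed
  then show ?thesis
    unfolding complex_root_form_def by (subst sum.swap) simp
qed

lemma lists_roots_image:
  assumes "f \<noteq> 0" and "lists_roots f n lam"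
  shows "lam ` {1..n} = {z. poly (map_poly complex_of_real f) z = 0}"
proof -
  have "lam ` {1..n} = set_mset (proots (map_poly complex_of_real f))"
    by (simp flip: assms(2)[unfolded lists_roots_def])
  then show ?thesis
    using assms(1) by (simp add: map_poly_eq_0_iff)
qed

lemma root_form_nonneg_if_real:
  assumes "\<And>l. l \<in> {1..n} \<Longrightarrow> lam l \<in> \<real>" and "even m"
  shows "root_form n lam m x \<ge> 0"
proof -
  have "0 \<le> Re ((\<Sum>j = 1..n. complex_of_real (x j) * lam l ^ (j - 1)) ^ m)"
    if l: "l \<in> {1..n}" for l
  proof -
    have "(\<Sum>j = 1..n. complex_of_real (x j) * lam l ^ (j - 1)) \<in> \<real>"
      using assms(1)[OF l] by (intro sum_in_Reals Reals_mult Reals_power) auto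
    then obtain r where "(\<Sum>j = 1..n. complex_of_real (x j) * lam l ^ (j - 1)) = complex_of_real r"
      by (elim Reals_cases)
    then show ?thesis
      using assms(2) by (simp add: zero_le_even_power flip: of_real_power)
  qed
  then show ?thesis
    unfolding root_form_def complex_root_form_eq_sum_powers Re_sum by (rule sum_nonneg)
qed

text \<open>
  The coefficientwise real part of \<open>Q\<close> takes the value \<open>(Q(z) + cnj (Q (cnj z))) / 2\<close> at \<open>z\<close>; hence
  it suffices that \<open>Q\<close> vanishes on \<open>S - {a}\<close> and has value \<open>2 w\<close> at \<open>a\<close>.
\<close>

lemma real_interpolation:
  fixes S :: "complex set"
  assumes "finite S" and "\<And>z. z \<in> S \<Longrightarrow> cnj z \<in> S" and "a \<in> S" and "a \<notin> \<real>" and "card S \<le> n"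
  obtains x :: "nat \<Rightarrow> real" where
    "(\<Sum>j = 1..n. complex_of_real (x j) * a ^ (j - 1)) = w"
    "(\<Sum>j = 1..n. complex_of_real (x j) * cnj a ^ (j - 1)) = cnj w"
    "\<And>z. z \<in> S - {a, cnj a} \<Longrightarrow> (\<Sum>j = 1..n. complex_of_real (x j) * z ^ (j - 1)) = 0"
proof -
  \<comment> \<open>Only the factor at \<open>a\<close> is left out; the one at \<open>cnj a\<close>
    stays. The degree is thus \<open>card S - 1\<close>, so n coefficients suffice.\<close>
  define R where "R = (\<Prod>s \<in> S - {a}. [:- s, 1:])"
  define Q where "Q = smult (2 * w / poly R a) R"
  define x where "x = (\<lambda>j. Re (coeff Q (j - 1)))"
  have "poly R a \<noteq> 0"
    using assms(1) by (auto simp: R_def poly_prod)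
  then have Qa: "poly Q a = 2 * w"
    by (simp add: Q_def)
  have Q0: "poly Q z = 0" if "z \<in> S - {a}" for z
    using assms(1) that by (auto simp: Q_def R_def poly_prod)
  have "degree R = card (S - {a})"
    unfolding R_def by (subst degree_prod_eq_sum_degree) auto
  also have "\<dots> < n"
    using assms(1,3,5) by (metis card_Diff1_less order_less_le_trans)
  finally have deg: "degree Q < n"
    using degree_smult_le[of _ R] by (auto simp: Q_def intro: le_less_trans)
  have coeffs: "(\<Sum>j = 1..n. coeff Q (j - 1) * z ^ (j - 1)) = poly Q z" for z
  proof -
    have "(\<Sum>j = 1..n. coeff Q (j - 1) * z ^ (j - 1)) = (\<Sum>i<n. coeff Q i * z ^ i)"
      by (rule sum.reindex_bij_witness[of _ Suc "\<lambda>j. j - 1"]) auto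
    also have "\<dots> = (\<Sum>i\<le>degree Q. coeff Q i * z ^ i)"
      using deg by (intro sum.mono_neutral_right) (auto simp: coeff_eq_0)
    finally show ?thesis
      by (simp add: poly_altdef)
  qed
  have val: "(\<Sum>j = 1..n. complex_of_real (x j) * z ^ (j - 1)) = (poly Q z + cnj (poly Q (cnj z))) / 2"
    for z
  proof -
    have "complex_of_real (x j) = (coeff Q (j - 1) + cnj (coeff Q (j - 1))) / 2" for j
      by (simp add: x_def complex_add_cnj)
    then show ?thesis
      by (simp add: algebra_simps add_divide_distrib sum.distrib sum_divide_distrib flip: coeffs)
  qed
  \<comment> \<open>Since \<open>a\<close> is not real, \<open>cnj a\<close> is a separate node
    where \<open>Q\<close> vanishes. So at \<open>a\<close>, and likewise at \<open>cnj a\<close>,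
    just one of the two terms in \<open>val\<close> survives, and halving \<open>2 * w\<close>
    leaves w or its conjugate.\<close>
  have ne: "cnj a \<noteq> a"
    using assms(4) by (metis Reals_cnj_iff)
  then have Qcnj: "poly Q (cnj a) = 0"
    using assms(2,3) by (intro Q0) auto
  show thesis
  proof (rule that[of x])
    fix z assume z: "z \<in> S - {a, cnj a}"
    then have "cnj z \<in> S - {a}"
      using assms(2) by auto
    then show "(\<Sum>j = 1..n. complex_of_real (x j) * z ^ (j - 1)) = 0"
      using z unfolding val by (simp add: Q0)
  qed (simp_all only: val Qa Qcnj complex_cnj_cnj, simp_all)
qed

text \<open>The value prescribed at a non-real root may depend on m, so a single m already detects
  such a root.\<close>

lemma lists_roots_real_if_pos_semidef:
  assumes "f \<noteq> 0" and "lists_roots f n lam" and "m > 0" and "pos_semidef n (root_form n lam m)"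
    and root: "poly (map_poly complex_of_real f) a = 0"
  shows "a \<in> \<real>"
proof (rule ccontr)
  assume "a \<notin> \<real>"
  define S where "S = lam ` {1..n}"
  have S: "S = {z. poly (map_poly complex_of_real f) z = 0}"
    unfolding S_def using lists_roots_image assms(1,2) .
  have cnj: "cnj z \<in> S" if "z \<in> S" for z
    using that by (simp add: S real_poly_cnj_root_iff coeff_map_poly)
  have "finite S" "card S \<le> n"
    using card_image_le[of "{1..n}" lam] by (simp_all add: S_def)
  have "a \<in> S"
    using root by (simp add: S)
  define w where "w = cis (pi / m)"
  have w: "w ^ m = -1"
    using \<open>m > 0\<close> by (simp add: w_def DeMoivre)
  obtain x :: "nat \<Rightarrow> real" where x:
    "(\<Sum>j = 1..n. complex_of_real (x j) * a ^ (j - 1)) = w"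
    "(\<Sum>j = 1..n. complex_of_real (x j) * cnj a ^ (j - 1)) = cnj w"
    "\<And>z. z \<in> S - {a, cnj a} \<Longrightarrow> (\<Sum>j = 1..n. complex_of_real (x j) * z ^ (j - 1)) = 0"
    by (rule real_interpolation[OF \<open>finite S\<close> cnj \<open>a \<in> S\<close> \<open>a \<notin> \<real>\<close> \<open>card S \<le> n\<close>, where w = w])
      (auto intro: that)
  \<comment> \<open>\<open>pos_semidef\<close> ranges over extensional points only, hence the
    restriction.\<close>
  define p where "p = (\<lambda>z. \<Sum>j = 1..n. complex_of_real (restrict x {1..n} j) * z ^ (j - 1))"
  have p: "p a = w" "p (cnj a) = cnj w" "\<And>z. z \<in> S - {a, cnj a} \<Longrightarrow> p z = 0"
    using x by (simp_all add: p_def)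
  \<comment> \<open>As -1 is real, \<open>cnj w\<close> is also an m-th root of -1; at the other
    roots, \<open>0 ^ m = 0\<close> because m is positive.\<close>
  have neg: "Re (p z ^ m) = (if z \<in> {a, cnj a} then - 1 else 0)" if "z \<in> S" for z
  proof -
    have "Re (cnj w ^ m) = - 1"
      using w by (metis cnj.sel(1) complex_cnj_power one_complex.sel(1) uminus_complex.sel(1))
    then show ?thesis
      using that p w \<open>m > 0\<close> by auto
  qed
  obtain k where k: "k \<in> {1..n}" "lam k = a"
    using \<open>a \<in> S\<close> by (auto simp: S_def)
  \<comment> \<open>Every summand is 0 or -1, and the one at k is -1; multiple roots merely repeat
    these values.\<close>
  have "(\<Sum>l = 1..n. Re (p (lam l) ^ m)) < (\<Sum>l = 1..n. 0)"
    using k by (intro sum_strict_mono_ex1) (auto simp: neg S_def)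
  then have "root_form n lam m (restrict x {1..n}) < 0"
    by (simp add: root_form_def complex_root_form_eq_sum_powers p_def)
  moreover have "root_form n lam m (restrict x {1..n}) \<ge> 0"
    using assms(4) by (auto simp: pos_semidef_def)
  ultimately show False
    by simp
qed

theorem theorem1:
  fixes f :: "real poly" and n :: nat and lam :: "nat \<Rightarrow> complex"
  assumes "degree f = n" and "n \<ge> 1" and "lists_roots f n lam"
  shows "((\<forall>z::complex. poly (map_poly complex_of_real f) z = 0 \<longrightarrow> z \<in> \<real>)
            \<longleftrightarrow> (\<forall>m>0. even m \<longrightarrow> pos_semidef n (root_form n lam m))) \<and>
         ((\<forall>m>0. even m \<longrightarrow> pos_semidef n (root_form n lam m))
            \<longleftrightarrow> (\<exists>m>0. even m \<and> pos_semidef n (root_form n lam m)))"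
    (is "(?a \<longleftrightarrow> ?b) \<and> (?b \<longleftrightarrow> ?c)")
proof -
  have nz: "f \<noteq> 0"
    using assms(1,2) by auto
  have "?b" if ?a
  proof -
    have "lam l \<in> \<real>" if "l \<in> {1..n}" for l
      using lists_roots_image[OF nz assms(3)] that \<open>?a\<close> by blast
    then show ?thesis
      unfolding pos_semidef_def using root_form_nonneg_if_real by blast
  qed
  moreover have "?c" if ?b
    using that by (intro exI[of _ 2]) simp
  moreover have "?a" if ?c
    using that lists_roots_real_if_pos_semidef[OF nz assms(3)] by blast
  ultimately show ?thesis
    by blast
qed

end
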